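(* Let $\Omega\subset\mathbb{R}^d$ be open and bounded and let $k:\mathbb{R}^d\times\mathbb{R}^d\to[0,\infty)$ be measurable. Assume that there is a symmetric, a.e. nonnegative function $L\in L^1(\mathbb{R}^d)$ with $|\{L>0\}|>0$ and a constant $c_0>0$ such that for all $u\in L^2(\Omega)$ (extended by $0$ to $\mathbb{R}^d$) $$\int_{\mathbb{R}^d}\int_{\mathbb{R}^d}(u(x)-u(y))^2k(x,y)\,dy\,dx\ \ge\ c_0\int_{\mathbb{R}^d}\int_{\mathbb{R}^d}(u(x)-u(y))^2L(x-y)\,dy\,dx .$$ Then there is a constant $C_P=C_P(\Omega,c_0,L)>0$ such that for all $u\in H_\Omega(\mathbb{R}^d;k)$ $$\|u\|^2_{L^2(\mathbb{R}^d)}\le C_P\int_{\mathbb{R}^d}\int_{\mathbb{R}^d}(u(x)-u(y))^2k(x,y)\,dy\,dx .$$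
   Context: $L$ symmetric means $L(z)=L(-z)$. With $k_s(x,y)=\frac12(k(x,y)+k(y,x))$, the standing assumption is that $x\mapsto\int_{\mathbb{R}^d}(1\wedge|x-y|^2)\,k_s(x,y)\,dy$ belongs to $L^1_{loc}(\mathbb{R}^d)$. The space $H_\Omega(\mathbb{R}^d;k)$ consists of all $u\in L^2(\mathbb{R}^d)$ with $u=0$ a.e. on $\mathbb{R}^d\setminus\Omega$ and $\int_{\mathbb{R}^d}\int_{\mathbb{R}^d}(u(x)-u(y))^2k_s(x,y)\,dy\,dx<\infty$. *)

theory Defs
  imports "HOL-Analysis.Analysis"
begin

text \<open>
  Function spaces consist of functions rather than of classes modulo null sets, and measurability is
  Lebesgue measurability. Integrals of nonnegative functions take values in \<^typ>\<open>ennreal\<close>, so that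
  energies may be infinite.
\<close>

definition L2_on :: "'a::euclidean_space set \<Rightarrow> ('a \<Rightarrow> real) set" where
  "L2_on S = {u. u \<in> borel_measurable (lebesgue_on S) \<and>
                 integrable (lebesgue_on S) (\<lambda>x. (u x)\<^sup>2)}"

definition L2_norm :: "('a::euclidean_space \<Rightarrow> real) \<Rightarrow> real" where
  "L2_norm u = sqrt (\<integral>x. (u x)\<^sup>2 \<partial>lebesgue)"

definition zero_ext :: "'a set \<Rightarrow> ('a \<Rightarrow> real) \<Rightarrow> 'a \<Rightarrow> real" where
  "zero_ext S u = (\<lambda>x. if x \<in> S then u x else 0)"

definition L1_loc :: "('a::euclidean_space \<Rightarrow> ennreal) set" where
  "L1_loc = {f. f \<in> borel_measurable lebesgue \<and>
                (\<forall>K. compact K \<longrightarrow> (\<integral>\<^sup>+x\<in>K. f x \<partial>lebesgue) < \<infinity>)}"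

definition sym_part :: "('a \<Rightarrow> 'a \<Rightarrow> real) \<Rightarrow> 'a \<Rightarrow> 'a \<Rightarrow> real" where
  "sym_part k x y = (k x y + k y x) / 2"

text \<open>
  The conversion \<^const>\<open>ennreal\<close> truncates negative values to zero. Below, kernels are nonnegative
  everywhere, or of the form \<open>L (x - y)\<close> with \<open>L\<close> nonnegative almost everywhere, so
  the truncation does not affect the integrals.
\<close>

definition energy :: "('a::euclidean_space \<Rightarrow> 'a \<Rightarrow> real) \<Rightarrow> ('a \<Rightarrow> real) \<Rightarrow> ennreal" where
  "energy k u = (\<integral>\<^sup>+x. (\<integral>\<^sup>+y. ennreal ((u x - u y)\<^sup>2 * k x y) \<partial>lebesgue) \<partial>lebesgue)"

definition admissible_kernel :: "('a::euclidean_space \<Rightarrow> 'a \<Rightarrow> real) \<Rightarrow> bool" where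
  "admissible_kernel k \<longleftrightarrow>
     (\<lambda>(x, y). k x y) \<in> borel_measurable (lebesgue :: ('a \<times> 'a) measure) \<and>
     (\<forall>x y. 0 \<le> k x y) \<and>
     (\<lambda>x. \<integral>\<^sup>+y. ennreal (min 1 ((norm (x - y))\<^sup>2) * sym_part k x y) \<partial>lebesgue) \<in> L1_loc"

definition H_space :: "'a::euclidean_space set \<Rightarrow> ('a \<Rightarrow> 'a \<Rightarrow> real) \<Rightarrow> ('a \<Rightarrow> real) set" where
  "H_space \<Omega> k = {u \<in> L2_on UNIV. (AE x in lebesgue. x \<notin> \<Omega> \<longrightarrow> u x = 0) \<and>
                                   energy (sym_part k) u < \<infinity>}"

end

theory Submission
  imports Defs
begin

text \<open>
  The quadratic form of an integrable kernel is a weighted superposition of difference quotients: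
  by Tonelli and the substitution \<open>h = x - y\<close>,
  \<open>\<integral>\<integral> (u x - u y)\<^sup>2 L (x - y) dy dx = \<integral> L h (\<integral> (u x - u (x - h))\<^sup>2 dx) dh\<close>.
  It therefore suffices to bound the norm of \<open>u\<close> by that of a single difference
  \<open>u - u (\<cdot> - h)\<close>, uniformly over a set of shifts \<open>h\<close> to which \<open>L\<close> gives positive mass.

  Shifts with \<open>norm h \<ge> r\<close>, for some \<open>r > 0\<close>, are such a set. Pick \<open>n\<close> with \<open>n * r\<close> larger than the
  diameter of \<open>\<Omega>\<close>. Shifting by \<open>n *\<^sub>R h\<close> moves \<open>\<Omega>\<close> off itself, so the difference of \<open>u\<close> and
  its shift by \<open>n *\<^sub>R h\<close> has at least the norm of \<open>u\<close>; on the other hand, telescoping and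
  translation invariance bound its norm by \<open>n\<close> times the norm of \<open>u - u (\<cdot> - h)\<close>
  (lemma \<open>nn_integral_iterated_shift_le\<close>). Hence
  \<open>(\<integral>u\<^sup>2) * \<integral>{norm h \<ge> r} L \<le> n\<^sup>2 * energy\<close> (lemma \<open>poincare_convolution_kernel\<close>). A small \<open>r\<close>
  makes the mass of \<open>L\<close> on \<open>{norm h \<ge> r}\<close> positive (lemma \<open>positive_mass_away_from_origin\<close>),
  because only a null set is lost as \<open>r\<close> tends to zero.

  Tonelli is applied to Borel representatives: for a merely Lebesgue measurable \<open>u\<close>, the function
  \<open>(x, h) \<mapsto> u (x - h)\<close> need not be measurable for the product of the Lebesgue \<open>\<sigma>\<close>-algebras. None of
  the integrals changes under modification on null sets.
\<close>

section \<open>Rigid motions of Lebesgue measure\<close>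

lemma nn_integral_lborel_translate:
  fixes f :: "'a::euclidean_space \<Rightarrow> ennreal"
  assumes [measurable]: "f \<in> borel_measurable borel"
  shows "(\<integral>\<^sup>+x. f (x + c) \<partial>lborel) = (\<integral>\<^sup>+x. f x \<partial>lborel)"
proof -
  have "(\<integral>\<^sup>+x. f x \<partial>lborel) = (\<integral>\<^sup>+x. f x \<partial>distr lborel borel ((+) c))"
    by (simp add: lborel_distr_plus)
  also have "\<dots> = (\<integral>\<^sup>+x. f (c + x) \<partial>lborel)"
    by (subst nn_integral_distr) auto
  finally show ?thesis by (simp add: add.commute)
qed

lemma lborel_distr_reflect:
  fixes c :: "'a::euclidean_space"
  shows "distr lborel borel (\<lambda>x. c - x) = lborel"
  by (subst (2) lborel_affine[of "-1" c]) (auto simp: density_1)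

lemma nn_integral_lborel_reflect:
  fixes f :: "'a::euclidean_space \<Rightarrow> ennreal"
  assumes [measurable]: "f \<in> borel_measurable borel"
  shows "(\<integral>\<^sup>+x. f (c - x) \<partial>lborel) = (\<integral>\<^sup>+x. f x \<partial>lborel)"
proof -
  have "(\<integral>\<^sup>+x. f x \<partial>lborel) = (\<integral>\<^sup>+x. f x \<partial>distr lborel borel (\<lambda>x. c - x))"
    by (simp add: lborel_distr_reflect)
  also have "\<dots> = (\<integral>\<^sup>+x. f (c - x) \<partial>lborel)"
    by (subst nn_integral_distr) auto
  finally show ?thesis by simp
qed

lemma AE_lborel_reflect:
  fixes c :: "'a::euclidean_space"
  assumes "AE x in lborel. P x"
  shows "AE x in lborel. P (c - x)"
proof -
  obtain N where N: "{x. \<not> P x} \<subseteq> N" "N \<in> null_sets lborel"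
    using assms unfolding eventually_ae_filter by auto
  have "AE x in distr lborel borel (\<lambda>x. c - x). x \<notin> N"
    using N by (simp add: lborel_distr_reflect AE_not_in)
  then have "AE x in lborel. c - x \<notin> N"
    using N by (subst (asm) AE_distr_iff) auto
  then show ?thesis
    using N by (auto elim!: eventually_mono)
qed

section \<open>Iterated shifts\<close>

lemma power2_diff_telescope_le:
  fixes a :: "nat \<Rightarrow> real"
  shows "(a n - a 0)\<^sup>2 \<le> real n * (\<Sum>i<n. (a (Suc i) - a i)\<^sup>2)"
  using sum_squared_le_sum_of_squares[of "\<lambda>i. a (Suc i) - a i" "{..<n}"]
  by (simp add: sum_lessThan_telescope mult.commute)

text \<open>
  By translation invariance each of the \<open>n\<close> telescoping increments has the same norm; this is the
  squared triangle inequality for \<open>L\<^sup>2\<close>, with the norms allowed to be infinite.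
\<close>

lemma nn_integral_iterated_shift_le:
  fixes u :: "'a::euclidean_space \<Rightarrow> real"
  assumes [measurable]: "u \<in> borel_measurable borel"
  shows "(\<integral>\<^sup>+x. ennreal ((u (x + real n *\<^sub>R h) - u x)\<^sup>2) \<partial>lborel)
       \<le> ennreal ((real n)\<^sup>2) * (\<integral>\<^sup>+x. ennreal ((u (x + h) - u x)\<^sup>2) \<partial>lborel)"
    (is "_ \<le> _ * ?D")
proof -
  have "(\<integral>\<^sup>+x. ennreal ((u (x + real n *\<^sub>R h) - u x)\<^sup>2) \<partial>lborel)
      \<le> (\<integral>\<^sup>+x. ennreal (real n)
           * (\<Sum>i<n. ennreal ((u (x + real i *\<^sub>R h + h) - u (x + real i *\<^sub>R h))\<^sup>2)) \<partial>lborel)"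
  proof (intro nn_integral_mono)
    fix x
    have "(u (x + real n *\<^sub>R h) - u x)\<^sup>2
        \<le> real n * (\<Sum>i<n. (u (x + real i *\<^sub>R h + h) - u (x + real i *\<^sub>R h))\<^sup>2)"
      using power2_diff_telescope_le[of "\<lambda>i. u (x + real i *\<^sub>R h)" n]
      by (simp add: algebra_simps)
    then show "ennreal ((u (x + real n *\<^sub>R h) - u x)\<^sup>2)
        \<le> ennreal (real n)
           * (\<Sum>i<n. ennreal ((u (x + real i *\<^sub>R h + h) - u (x + real i *\<^sub>R h))\<^sup>2))"
      by (simp add: sum_ennreal ennreal_mult[symmetric] sum_nonneg ennreal_leI)
  qed
  also have "\<dots> = ennreal (real n)
      * (\<Sum>i<n. \<integral>\<^sup>+x. ennreal ((u (x + real i *\<^sub>R h + h) - u (x + real i *\<^sub>R h))\<^sup>2) \<partial>lborel)"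
    by (simp add: nn_integral_cmult nn_integral_sum del: sum_ennreal)
  also have "\<dots> = ennreal (real n) * (\<Sum>i<n. ?D)"
    by (subst nn_integral_lborel_translate[where f = "\<lambda>x. ennreal ((u (x + h) - u x)\<^sup>2)"]) auto
  also have "\<dots> = ennreal ((real n)\<^sup>2) * ?D"
    by (simp add: power2_eq_square ennreal_mult ennreal_of_nat_eq_real_of_nat mult.assoc)
  finally show ?thesis .
qed

text \<open>
  If \<open>norm (n *\<^sub>R h)\<close> exceeds the diameter of the support, then on the support the shifted function
  vanishes, and off the support there is nothing to bound.
\<close>

lemma nn_integral_power2_le_shift_difference:
  fixes u :: "'a::euclidean_space \<Rightarrow> real"
  assumes [measurable]: "u \<in> borel_measurable borel"
    and supp: "\<And>x. u x \<noteq> 0 \<Longrightarrow> norm x \<le> B"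
    and large: "2 * B < real n * norm h"
  shows "(\<integral>\<^sup>+x. ennreal ((u x)\<^sup>2) \<partial>lborel)
       \<le> ennreal ((real n)\<^sup>2) * (\<integral>\<^sup>+x. ennreal ((u (x + h) - u x)\<^sup>2) \<partial>lborel)"
proof -
  have "(u x)\<^sup>2 \<le> (u (x + real n *\<^sub>R h) - u x)\<^sup>2" for x
  proof (cases "u x = 0")
    case False
    have "real n * norm h \<le> norm (x + real n *\<^sub>R h) + norm x"
      using norm_triangle_ineq4[of "x + real n *\<^sub>R h" x] by simp
    then have "u (x + real n *\<^sub>R h) = 0"
      using supp[OF False] supp[of "x + real n *\<^sub>R h"] large by force
    then show ?thesis by simp
  qed simp
  then have "(\<integral>\<^sup>+x. ennreal ((u x)\<^sup>2) \<partial>lborel)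
      \<le> (\<integral>\<^sup>+x. ennreal ((u (x + real n *\<^sub>R h) - u x)\<^sup>2) \<partial>lborel)"
    by (intro nn_integral_mono ennreal_leI)
  also note nn_integral_iterated_shift_le
  finally show ?thesis by simp
qed

section \<open>Energies of convolution kernels\<close>

lemma energy_cong_AE:
  assumes "AE x in lebesgue. u x = v x"
  shows "energy k u = energy k v"
  unfolding energy_def
proof (rule nn_integral_cong_AE, use assms in eventually_elim)
  case (elim x)
  show ?case
    by (rule nn_integral_cong_AE, use assms in eventually_elim) (simp add: elim)
qed

lemma energy_convolution_cong_AE:
  fixes L M :: "'a::euclidean_space \<Rightarrow> real"
  assumes "AE z in lebesgue. L z = M z"
  shows "energy (\<lambda>x y. L (x - y)) u = energy (\<lambda>x y. M (x - y)) u"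
proof -
  have "AE z in lborel. L z = M z"
    using assms by (simp add: AE_completion_iff)
  then have "AE y in lebesgue. L (x - y) = M (x - y)" for x
    by (intro AE_completion AE_lborel_reflect)
  then have "AE y in lebesgue. ennreal ((u x - u y)\<^sup>2 * L (x - y))
      = ennreal ((u x - u y)\<^sup>2 * M (x - y))" for x
    by (rule eventually_mono[where P = "\<lambda>y. L (x - y) = M (x - y)"]) simp
  then show ?thesis
    unfolding energy_def by (intro nn_integral_cong[OF nn_integral_cong_AE])
qed

lemma energy_convolution_eq:
  fixes u M :: "'a::euclidean_space \<Rightarrow> real"
  assumes [measurable]: "u \<in> borel_measurable borel" "M \<in> borel_measurable borel"
  shows "energy (\<lambda>x y. M (x - y)) u
       = (\<integral>\<^sup>+h. ennreal (M h) * (\<integral>\<^sup>+x. ennreal ((u (x + h) - u x)\<^sup>2) \<partial>lborel) \<partial>lborel)"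
proof -
  have "energy (\<lambda>x y. M (x - y)) u
      = (\<integral>\<^sup>+x. \<integral>\<^sup>+y. ennreal ((u x - u y)\<^sup>2 * M (x - y)) \<partial>lborel \<partial>lborel)"
    by (simp add: energy_def nn_integral_completion)
  also have "\<dots> = (\<integral>\<^sup>+x. \<integral>\<^sup>+h. ennreal ((u x - u (x - h))\<^sup>2 * M h) \<partial>lborel \<partial>lborel)"
  proof (rule nn_integral_cong)
    fix x
    show "(\<integral>\<^sup>+y. ennreal ((u x - u y)\<^sup>2 * M (x - y)) \<partial>lborel)
        = (\<integral>\<^sup>+h. ennreal ((u x - u (x - h))\<^sup>2 * M h) \<partial>lborel)"
      using nn_integral_lborel_reflect[of "\<lambda>h. ennreal ((u x - u (x - h))\<^sup>2 * M h)" x] by simp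
  qed
  also have "\<dots> = (\<integral>\<^sup>+h. \<integral>\<^sup>+x. ennreal ((u x - u (x - h))\<^sup>2 * M h) \<partial>lborel \<partial>lborel)"
    by (rule lborel_pair.Fubini') measurable
  also have "\<dots> = (\<integral>\<^sup>+h. \<integral>\<^sup>+x. ennreal ((u (x + h) - u x)\<^sup>2 * M h) \<partial>lborel \<partial>lborel)"
  proof (rule nn_integral_cong)
    fix h
    show "(\<integral>\<^sup>+x. ennreal ((u x - u (x - h))\<^sup>2 * M h) \<partial>lborel)
        = (\<integral>\<^sup>+x. ennreal ((u (x + h) - u x)\<^sup>2 * M h) \<partial>lborel)"
      using nn_integral_lborel_translate[of "\<lambda>x. ennreal ((u x - u (x - h))\<^sup>2 * M h)" h] by simp
  qed
  also have "\<dots> = (\<integral>\<^sup>+h. ennreal (M h) * (\<integral>\<^sup>+x. ennreal ((u (x + h) - u x)\<^sup>2) \<partial>lborel) \<partial>lborel)"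
  proof (rule nn_integral_cong)
    fix h
    have "(\<integral>\<^sup>+x. ennreal ((u (x + h) - u x)\<^sup>2 * M h) \<partial>lborel)
        = (\<integral>\<^sup>+x. ennreal ((u (x + h) - u x)\<^sup>2) * ennreal (M h) \<partial>lborel)"
      by (intro nn_integral_cong ennreal_mult') simp
    then show "(\<integral>\<^sup>+x. ennreal ((u (x + h) - u x)\<^sup>2 * M h) \<partial>lborel)
        = ennreal (M h) * (\<integral>\<^sup>+x. ennreal ((u (x + h) - u x)\<^sup>2) \<partial>lborel)"
      by (subst (asm) nn_integral_multc) (auto simp: mult.commute[of "ennreal (M h)"])
  qed
  finally show ?thesis .
qed

lemma poincare_convolution_kernel:
  fixes u L :: "'a::euclidean_space \<Rightarrow> real"
  assumes u: "u \<in> borel_measurable lebesgue" and L: "L \<in> borel_measurable lebesgue"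
    and supp: "\<And>x. u x \<noteq> 0 \<Longrightarrow> norm x \<le> B"
    and large: "2 * B < real n * r"
  shows "(\<integral>\<^sup>+x. ennreal ((u x)\<^sup>2) \<partial>lebesgue)
           * (\<integral>\<^sup>+h. ennreal (L h) * indicator {h. r \<le> norm h} h \<partial>lebesgue)
       \<le> ennreal ((real n)\<^sup>2) * energy (\<lambda>x y. L (x - y)) u"
proof -
  obtain v where [measurable]: "v \<in> borel_measurable borel" and v: "AE x in lebesgue. u x = v x"
    using completion_ex_borel_measurable_real[OF u] by (auto intro: AE_completion)
  obtain M where [measurable]: "M \<in> borel_measurable borel" and M: "AE x in lebesgue. L x = M x"
    using completion_ex_borel_measurable_real[OF L] by (auto intro: AE_completion)
  \<comment> \<open>The representative may be nonzero on a null set outside the ball, so it is cut off there.\<close>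
  define w where "w = (\<lambda>x. v x * indicator (cball 0 B) x)"
  have [measurable]: "w \<in> borel_measurable borel" unfolding w_def by (intro borel_measurable_times borel_measurable_indicator) auto
  have w: "AE x in lebesgue. u x = w x"
    using v by eventually_elim (use supp in \<open>force simp: w_def indicator_def\<close>)
  have w_supp: "norm x \<le> B" if "w x \<noteq> 0" for x
    using that by (auto simp: w_def indicator_def split: if_splits)
  let ?D = "\<lambda>h. \<integral>\<^sup>+x. ennreal ((w (x + h) - w x)\<^sup>2) \<partial>lborel"
  let ?N = "\<integral>\<^sup>+x. ennreal ((w x)\<^sup>2) \<partial>lborel"
  have "(\<integral>\<^sup>+x. ennreal ((u x)\<^sup>2) \<partial>lebesgue)
         * (\<integral>\<^sup>+h. ennreal (L h) * indicator {h. r \<le> norm h} h \<partial>lebesgue)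
      = (\<integral>\<^sup>+x. ennreal ((w x)\<^sup>2) \<partial>lebesgue)
         * (\<integral>\<^sup>+h. ennreal (M h) * indicator {h. r \<le> norm h} h \<partial>lebesgue)"
    by (intro arg_cong2[where f = "(*)"] nn_integral_cong_AE eventually_mono[OF w]
          eventually_mono[OF M]) auto
  also have "\<dots> = (\<integral>\<^sup>+h. ?N * (ennreal (M h) * indicator {h. r \<le> norm h} h) \<partial>lborel)"
    by (simp add: nn_integral_completion nn_integral_cmult)
  also have "\<dots> \<le> (\<integral>\<^sup>+h. ennreal ((real n)\<^sup>2) * (ennreal (M h) * ?D h) \<partial>lborel)"
  proof (rule nn_integral_mono)
    fix h
    show "?N * (ennreal (M h) * indicator {h. r \<le> norm h} h)
        \<le> ennreal ((real n)\<^sup>2) * (ennreal (M h) * ?D h)"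
    proof (cases "r \<le> norm h")
      case True
      then have "2 * B < real n * norm h"
        using large by (smt (verit) mult_left_mono of_nat_0_le_iff)
      then have "?N \<le> ennreal ((real n)\<^sup>2) * ?D h"
        by (intro nn_integral_power2_le_shift_difference[where B = B] w_supp) auto
      from mult_right_mono[OF this, of "ennreal (M h)"] True show ?thesis
        by (simp add: ac_simps)
    qed simp
  qed
  also have "\<dots> = ennreal ((real n)\<^sup>2) * energy (\<lambda>x y. M (x - y)) w"
    by (simp add: energy_convolution_eq nn_integral_cmult)
  also have "energy (\<lambda>x y. M (x - y)) w = energy (\<lambda>x y. L (x - y)) u"
    using energy_cong_AE[OF w] energy_convolution_cong_AE[OF M] by simp
  finally show ?thesis .
qed

section \<open>The Poincare inequality\<close>

text \<open>
  If no \<open>r\<close> worked, then \<open>L \<le> 0\<close> almost everywhere outside each ball of radius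
  \<open>inverse (Suc j)\<close> around the origin, and hence, as the origin is a null set, almost everywhere.
\<close>

lemma positive_mass_away_from_origin:
  fixes L :: "'a::euclidean_space \<Rightarrow> real"
  assumes [measurable]: "L \<in> borel_measurable lebesgue"
    and pos: "emeasure lebesgue {z. 0 < L z} > 0"
  obtains r where "r > 0" "(\<integral>\<^sup>+h. ennreal (L h) * indicator {h. r \<le> norm h} h \<partial>lebesgue) > 0"
proof (rule ccontr)
  note away = that
  assume none: "\<not> thesis"
  have 0: "(\<integral>\<^sup>+h. ennreal (L h) * indicator {h. r \<le> norm h} h \<partial>lebesgue) = 0" if "r > 0" for r
    using none away[OF that] by (meson not_gr_zero)
  have [measurable]: "{h::'a. r \<le> norm h} \<in> sets lebesgue" for r
    by (intro sets_completionI_sets) (simp add: borel_closed closed_Collect_le continuous_on_norm_id)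
  have "AE h in lebesgue. \<forall>j. ennreal (L h) * indicator {h. inverse (real (Suc j)) \<le> norm h} h = 0"
    unfolding AE_all_countable
  proof
    fix j
    show "AE h in lebesgue. ennreal (L h) * indicator {h. inverse (real (Suc j)) \<le> norm h} h = 0"
      using 0[of "inverse (real (Suc j))"] by (simp add: nn_integral_0_iff_AE del: mult_eq_0_iff)
  qed
  moreover have "AE h in lebesgue. h \<noteq> (0::'a)"
    by (intro AE_completion AE_lborel_singleton)
  ultimately have "AE h in lebesgue. \<not> 0 < L h"
  proof eventually_elim
    case (elim h)
    then obtain j where "inverse (real (Suc j)) < norm h"
      using reals_Archimedean[of "norm h"] by auto
    with elim(1) have "ennreal (L h) = 0"
      by (auto dest!: spec[of _ j])
    then show ?case by (simp add: ennreal_eq_0_iff)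
  qed
  moreover have "{z. 0 < L z} \<in> sets lebesgue"
    using measurable_sets[OF assms(1), of "{0<..}"] by (simp add: vimage_def)
  ultimately have "emeasure lebesgue {z. 0 < L z} = 0"
    by (subst (asm) AE_iff_measurable[OF _ refl]) auto
  with pos show False by simp
qed

theorem lemma2p7:
  fixes \<Omega> :: "'a::euclidean_space set"
    and L :: "'a \<Rightarrow> real"
    and c\<^sub>0 :: real
  assumes "open \<Omega>" and "bounded \<Omega>"
    and "integrable lebesgue L"
    and "\<forall>z. L z = L (- z)"
    and "AE z in lebesgue. 0 \<le> L z"
    and "emeasure lebesgue {z. 0 < L z} > 0"
    and "c\<^sub>0 > 0"
  shows "\<exists>C\<^sub>P>0. \<forall>k :: 'a \<Rightarrow> 'a \<Rightarrow> real.
           admissible_kernel k \<longrightarrow>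
           (\<forall>u \<in> L2_on \<Omega>. energy k (zero_ext \<Omega> u) \<ge>
                          ennreal c\<^sub>0 * energy (\<lambda>x y. L (x - y)) (zero_ext \<Omega> u)) \<longrightarrow>
           (\<forall>u \<in> H_space \<Omega> k. ennreal ((L2_norm u)\<^sup>2) \<le> ennreal C\<^sub>P * energy k u)"
proof -
  have L: "L \<in> borel_measurable lebesgue"
    using assms(3) by auto
  have \<Omega>: "\<Omega> \<in> sets lebesgue"
    using assms(1) by auto
  obtain B where B: "\<And>x. x \<in> \<Omega> \<Longrightarrow> norm x \<le> B"
    using assms(2) unfolding bounded_iff by auto
  obtain r where r: "r > 0"
    and mass_pos: "(\<integral>\<^sup>+h. ennreal (L h) * indicator {h. r \<le> norm h} h \<partial>lebesgue) > 0"
    using positive_mass_away_from_origin[OF L assms(6)] by blast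
  obtain n where n: "2 * B < real n * r"
    using reals_Archimedean3[OF r] by blast
  have "(\<integral>\<^sup>+h. ennreal (L h) * indicator {h. r \<le> norm h} h \<partial>lebesgue)
      \<le> (\<integral>\<^sup>+h. ennreal (norm (L h)) \<partial>lebesgue)"
    by (intro nn_integral_mono) (auto simp: indicator_def intro: ennreal_leI)
  also have "\<dots> < \<infinity>"
    using assms(3) by (simp add: integrable_iff_bounded)
  finally obtain m where m: "m > 0"
    and mass: "(\<integral>\<^sup>+h. ennreal (L h) * indicator {h. r \<le> norm h} h \<partial>lebesgue) = ennreal m"
    using mass_pos by (cases "\<integral>\<^sup>+h. ennreal (L h) * indicator {h. r \<le> norm h} h \<partial>lebesgue") auto
  \<comment> \<open>Adding 1 keeps the constant positive when \<open>n = 0\<close>, as can happen if \<open>\<Omega>\<close> is empty.\<close>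
  define C where "C = ((real n)\<^sup>2 + 1) / (m * c\<^sub>0)"
  have C: "C > 0"
    using m assms(7) by (simp add: C_def add_nonneg_pos)
  show ?thesis
  proof (intro exI[of _ C] conjI C allI impI ballI)
    fix k :: "'a \<Rightarrow> 'a \<Rightarrow> real" and u
    assume coercive: "\<forall>u \<in> L2_on \<Omega>. energy k (zero_ext \<Omega> u) \<ge>
        ennreal c\<^sub>0 * energy (\<lambda>x y. L (x - y)) (zero_ext \<Omega> u)"
      and "u \<in> H_space \<Omega> k"
    then have u: "u \<in> borel_measurable lebesgue" and u2: "integrable lebesgue (\<lambda>x. (u x)\<^sup>2)"
      and vanish: "AE x in lebesgue. x \<notin> \<Omega> \<longrightarrow> u x = 0"
      by (auto simp: H_space_def L2_on_def lebesgue_on_UNIV_eq)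
    let ?v = "zero_ext \<Omega> u"
    have uv: "AE x in lebesgue. u x = ?v x"
      using vanish by eventually_elim (auto simp: zero_ext_def)
    have v: "?v \<in> borel_measurable lebesgue"
      unfolding zero_ext_def using u \<Omega> by (intro measurable_If_set) auto
    have "u \<in> L2_on \<Omega>"
      unfolding L2_on_def
      using measurable_restrict_space1[OF u] integrable_restrict_space[of \<Omega> lebesgue "\<lambda>x. (u x)\<^sup>2"]
        \<Omega> integrable_mult_indicator[OF \<Omega> u2] by auto
    then have le: "ennreal c\<^sub>0 * energy (\<lambda>x y. L (x - y)) ?v \<le> energy k u"
      using coercive energy_cong_AE[OF uv] by metis
    have norm_eq: "ennreal ((L2_norm u)\<^sup>2) = (\<integral>\<^sup>+x. ennreal ((?v x)\<^sup>2) \<partial>lebesgue)"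
    proof -
      have "ennreal ((L2_norm u)\<^sup>2) = (\<integral>\<^sup>+x. ennreal ((u x)\<^sup>2) \<partial>lebesgue)"
        by (simp add: L2_norm_def nn_integral_eq_integral[OF u2])
      also have "\<dots> = (\<integral>\<^sup>+x. ennreal ((?v x)\<^sup>2) \<partial>lebesgue)"
        by (intro nn_integral_cong_AE eventually_mono[OF uv]) simp
      finally show ?thesis .
    qed
    have "ennreal (m * c\<^sub>0) * ennreal ((L2_norm u)\<^sup>2)
        = ennreal c\<^sub>0 * ((\<integral>\<^sup>+x. ennreal ((?v x)\<^sup>2) \<partial>lebesgue) * ennreal m)"
      using m assms(7) by (simp add: norm_eq ennreal_mult ac_simps)
    also have "\<dots> \<le> ennreal c\<^sub>0 * (ennreal ((real n)\<^sup>2) * energy (\<lambda>x y. L (x - y)) ?v)"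
      unfolding mass[symmetric]
      by (intro mult_left_mono poincare_convolution_kernel[OF v L _ n])
        (auto simp: zero_ext_def B split: if_splits)
    also have "\<dots> \<le> ennreal ((real n)\<^sup>2) * energy k u"
      using mult_left_mono[OF le, of "ennreal ((real n)\<^sup>2)"] by (simp add: ac_simps)
    also have "\<dots> \<le> ennreal ((real n)\<^sup>2 + 1) * energy k u"
      by (intro mult_right_mono ennreal_leI) auto
    finally have "ennreal (1 / (m * c\<^sub>0)) * (ennreal (m * c\<^sub>0) * ennreal ((L2_norm u)\<^sup>2))
        \<le> ennreal (1 / (m * c\<^sub>0)) * (ennreal ((real n)\<^sup>2 + 1) * energy k u)"
      by (intro mult_left_mono) auto
    moreover have "ennreal (1 / (m * c\<^sub>0)) * ennreal (m * c\<^sub>0) = 1"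
      using m assms(7) by (simp flip: ennreal_mult)
    moreover have "ennreal (1 / (m * c\<^sub>0)) * ennreal ((real n)\<^sup>2 + 1) = ennreal C"
      using m assms(7) by (subst ennreal_mult[symmetric]) (auto simp: C_def)
    ultimately show "ennreal ((L2_norm u)\<^sup>2) \<le> ennreal C * energy k u"
      by (metis mult.assoc mult_1)
  qed
qed

end
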